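(* Fix arbitrary positive numbers $r'>r>0$ and arbitrary two Young diagrams $\mu$ and $\nu$ such that $\mu\subseteq\nu$. Let two positive integers $N'>N$ go to infinity in such a way that $N'/N\to r'/r$. Then $$\lim{}^{\mathbb{GT}}\Lambda^{N'}_N([\nu,N'],[\mu,N])={}^{\mathbb{YB}}\Lambda^{r'}_r(\nu,\mu).$$
   Context: **Gelfand–Tsetlin graph.** A signature of length $N$ is an $N$-tuple of integers $\mu_1\ge\dots\ge\mu_N$; $\mathbb{GT}_N$ is the set of these. Write $\mu\prec\nu$ for $\mu\in\mathbb{GT}_N$, $\nu\in\mathbb{GT}_{N+1}$ if $\nu_j\ge\mu_j\ge\nu_{j+1}$ for all $j=1,\dots,N$. The graph $\mathbb{GT}$ has vertex set $\bigsqcup_{N\ge1}\mathbb{GT}_N$ and simple edges joining $\mu$ and $\nu$ whenever $\mu\prec\nu$. A Young diagram $\mu$ with $\ell(\mu)\le N$ nonzero rows is viewed as the signature $[\mu,N]\in\mathbb{GT}_N$ obtained by appending zeros. $\mathrm{Dim}[\mu,N]$ is the number of sequences $\lambda^{(1)}\prec\lambda^{(2)}\prec\dots\prec\lambda^{(N)}=\mu$ with $\lambda^{(i)}\in\mathbb{GT}_i$; equivalently, $\mathrm{Dim}[\mu,N]=\prod_{1\le i<j\le N}\frac{\mu_i-\mu_j-i+j}{j-i}$. For $N'>N$, $\mathrm{Dim}([\mu,N],[\nu,N'])$ is the number of sequences $\mu=\lambda^{(N)}\prec\lambda^{(N+1)}\prec\dots\prec\lambda^{(N')}=\nu$ with $\lambda^{(i)}\in\mathbb{GT}_i$.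 The links are $${}^{\mathbb{GT}}\Lambda^{N'}_N([\nu,N'],[\mu,N])=\frac{\mathrm{Dim}[\mu,N]\;\mathrm{Dim}([\mu,N],[\nu,N'])}{\mathrm{Dim}[\nu,N']}.$$ They are defined for the given $\mu,\nu$ as soon as $N\ge\ell(\mu)$, $N'\ge\ell(\nu)$. **Young bouquet links.** For Young diagrams $\mu,\nu$ with $m=|\mu|$, $n=|\nu|$ boxes and $r'>r>0$, $${}^{\mathbb{YB}}\Lambda^{r'}_{r}(\nu,\mu)=\Bigl(1-\frac{r}{r'}\Bigr)^{n-m}\Bigl(\frac{r}{r'}\Bigr)^m\frac{n!}{(n-m)!\,m!}\,\frac{\dim\mu\,\dim(\mu,\nu)}{\dim\nu}$$ if $\mu\subseteq\nu$, and $0$ otherwise, where $\dim\mu$ is the number of standard Young tableaux of shape $\mu$ ($\dim\varnothing=1$), and $\dim(\mu,\nu)$ is the number of standard tableaux of skew shape $\nu/\mu$ (equal to $1$ if $\mu=\nu$). *)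

theory Defs
  imports Complex_Main "HOL-Library.FuncSet"
begin

(* Signatures of length N are lists of integers; list positions are 0-based. *)

definition GT :: "nat \<Rightarrow> int list set" where
  "GT N = {\<mu>. length \<mu> = N \<and> sorted_wrt (\<ge>) \<mu>}"

definition interlaces :: "int list \<Rightarrow> int list \<Rightarrow> bool" where
  "interlaces \<mu> \<nu> \<longleftrightarrow> length \<nu> = Suc (length \<mu>) \<and>
     (\<forall>j < length \<mu>. \<nu> ! j \<ge> \<mu> ! j \<and> \<mu> ! j \<ge> \<nu> ! Suc j)"

(* Sequences \<lambda>^(N), ..., \<lambda>^(N'), made extensional so that card counts each one once. *)
definition GT_paths :: "nat \<Rightarrow> nat \<Rightarrow> (nat \<Rightarrow> int list) set" where
  "GT_paths N N' = {l \<in> (\<Pi>\<^sub>E i \<in> {N..N'}. GT i). \<forall>i \<in> {N..<N'}. interlaces (l i) (l (Suc i))}"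

(* The two counted sets are finite for N \<ge> 1: interlacing bounds every entry of a path by
   the largest and smallest entries of its endpoint. *)
definition GT_Dim :: "nat \<Rightarrow> int list \<Rightarrow> nat" where
  "GT_Dim N \<mu> = card {l \<in> GT_paths 1 N. l N = \<mu>}"

definition GT_Dim_between :: "nat \<Rightarrow> int list \<Rightarrow> nat \<Rightarrow> int list \<Rightarrow> nat" where
  "GT_Dim_between N \<mu> N' \<nu> = card {l \<in> GT_paths N N'. l N = \<mu> \<and> l N' = \<nu>}"

definition GT_link :: "nat \<Rightarrow> nat \<Rightarrow> int list \<Rightarrow> int list \<Rightarrow> real" where
  "GT_link N' N \<nu> \<mu> =
     real (GT_Dim N \<mu>) * real (GT_Dim_between N \<mu> N' \<nu>) / real (GT_Dim N' \<nu>)"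

(* A Young diagram is the list of its nonzero row lengths. *)

definition young_diagram :: "nat list \<Rightarrow> bool" where
  "young_diagram \<mu> \<longleftrightarrow> sorted_wrt (\<ge>) \<mu> \<and> 0 \<notin> set \<mu>"

definition boxes :: "nat list \<Rightarrow> (nat \<times> nat) set" where
  "boxes \<mu> = {(i, j). i < length \<mu> \<and> j < \<mu> ! i}"

(* The signature [\<mu>, N]; meaningful only when length \<mu> \<le> N. *)
definition signature_of :: "nat list \<Rightarrow> nat \<Rightarrow> int list" where
  "signature_of \<mu> N = map int \<mu> @ replicate (N - length \<mu>) 0"

(* S is the set of boxes of a (skew) shape. *)
definition standard_tableaux :: "(nat \<times> nat) set \<Rightarrow> (nat \<times> nat \<Rightarrow> nat) set" where
  "standard_tableaux S = {T \<in> extensional S. bij_betw T S {1..card S} \<and>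
     (\<forall>i j j'. (i, j) \<in> S \<and> (i, j') \<in> S \<and> j < j' \<longrightarrow> T (i, j) < T (i, j')) \<and>
     (\<forall>i i' j. (i, j) \<in> S \<and> (i', j) \<in> S \<and> i < i' \<longrightarrow> T (i, j) < T (i', j))}"

definition YB_dim :: "nat list \<Rightarrow> nat" where
  "YB_dim \<mu> = card (standard_tableaux (boxes \<mu>))"

definition YB_dim_between :: "nat list \<Rightarrow> nat list \<Rightarrow> nat" where
  "YB_dim_between \<mu> \<nu> = card (standard_tableaux (boxes \<nu> - boxes \<mu>))"

definition YB_link :: "real \<Rightarrow> real \<Rightarrow> nat list \<Rightarrow> nat list \<Rightarrow> real" where
  "YB_link r' r \<nu> \<mu> =
     (if boxes \<mu> \<subseteq> boxes \<nu> then
        let m = sum_list \<mu>; n = sum_list \<nu> in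
          (1 - r / r') ^ (n - m) * (r / r') ^ m * (fact n / (fact (n - m) * fact m)) *
          (real (YB_dim \<mu>) * real (YB_dim_between \<mu> \<nu>) / real (YB_dim \<nu>))
      else 0)"

end

theory Submission
  imports Defs
begin

text \<open>
  Both links are built from numbers of chains of shapes. Pad a nonnegative signature with zeros and
  view it as a weakly decreasing sequence of row lengths; then \<open>\<mu> \<prec> \<nu>\<close> says that \<open>\<nu> / \<mu>\<close> is a
  horizontal strip, that is, no two of its boxes lie in one column. Hence the number of paths from
  \<open>[\<mu>, N]\<close> to \<open>[\<nu>, N']\<close> is the number of chains of \<open>N' - N\<close> possibly empty horizontal strips that
  lead from \<open>\<mu>\<close> to \<open>\<nu>\<close>, and depends on \<open>N' - N\<close> only. In the same way \<open>Dim [\<mu>, N]\<close> counts the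
  chains of \<open>N\<close> strips from the empty shape (\<open>GT_Dim_between_eq_strip_chains\<close>,
  \<open>GT_Dim_eq_strip_chains\<close>).

  A chain of \<open>k\<close> strips is determined by its nonempty strips and by their positions among the \<open>k\<close>
  steps. If \<open>c j\<close> is the number of chains of \<open>j\<close> nonempty strips, the number of chains is therefore
  \<open>(\<Sum>j. (k choose j) * c j)\<close> (\<open>strip_chains_binomial\<close>), a polynomial in \<open>k\<close>. With
  \<open>d = |\<nu>| - |\<mu>|\<close>, no chain has more than \<open>d\<close> nonempty strips, and a chain of exactly \<open>d\<close> of them
  adds one box at a time, so that it is a standard tableau of shape \<open>\<nu> / \<mu>\<close>
  (\<open>proper_strip_chains_maximal\<close>). The number of chains thus grows like
  \<open>dim (\<mu>, \<nu>) * k ^ d / d!\<close> (\<open>strip_chains_asymptotics\<close>).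

  Put this into the three dimensions of the link, with \<open>m = |\<mu>|\<close> and \<open>n = |\<nu>|\<close>. The powers
  combine to \<open>N ^ m * (N' - N) ^ (n - m) / N' ^ n\<close>, which tends to
  \<open>(r / r') ^ m * (1 - r / r') ^ (n - m)\<close>, and the factorials combine to the binomial coefficient.
\<close>

section \<open>Standard tableaux and removal of the largest entry\<close>

text \<open>For a skew shape \<open>\<nu> / \<mu>\<close> these are the boxes that can be removed from \<open>\<nu>\<close>. The definition
  makes sense for any set of boxes, and the branching rule below holds at that generality.\<close>
definition outer_boxes :: "(nat \<times> nat) set \<Rightarrow> (nat \<times> nat) set" where
  "outer_boxes S = {(i, j) \<in> S. (\<forall>j'>j. (i, j') \<notin> S) \<and> (\<forall>i'>i. (i', j) \<notin> S)}"

lemma standard_tableaux_bij: "T \<in> standard_tableaux S \<Longrightarrow> bij_betw T S {1..card S}"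
  by (simp add: standard_tableaux_def)

lemma standard_tableauxI:
  assumes "T \<in> extensional S" "bij_betw T S {1..card S}"
    and "\<And>i j j'. (i, j) \<in> S \<Longrightarrow> (i, j') \<in> S \<Longrightarrow> j < j' \<Longrightarrow> T (i, j) < T (i, j')"
    and "\<And>i i' j. (i, j) \<in> S \<Longrightarrow> (i', j) \<in> S \<Longrightarrow> i < i' \<Longrightarrow> T (i, j) < T (i', j)"
  shows "T \<in> standard_tableaux S"
  using assms unfolding standard_tableaux_def by blast

lemma finite_standard_tableaux:
  assumes "finite S"
  shows "finite (standard_tableaux S)"
proof (rule finite_subset)
  show "standard_tableaux S \<subseteq> (\<Pi>\<^sub>E b\<in>S. {1..card S})"
    by (auto simp: standard_tableaux_def PiE_def bij_betw_def)
  show "finite (\<Pi>\<^sub>E b\<in>S. {1..card S})"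
    using assms by (intro finite_PiE) auto
qed

lemma standard_tableaux_empty: "card (standard_tableaux {}) = 1"
proof -
  have "standard_tableaux {} = {\<lambda>_. undefined}"
    by (auto simp: standard_tableaux_def bij_betw_def)
  then show ?thesis by simp
qed

lemma outer_box_of_largest_entry:
  assumes T: "T \<in> standard_tableaux S" and b: "b \<in> S" "T b = card S"
  shows "b \<in> outer_boxes S"
proof -
  obtain i j where ij: "b = (i, j)" by force
  have le: "T c \<le> card S" if "c \<in> S" for c
    using standard_tableaux_bij[OF T] that by (auto simp: bij_betw_def)
  have rows: "T (i, j) < T (i, j')" if "(i, j') \<in> S" "j < j'" for j'
    using T b that unfolding ij standard_tableaux_def by blast
  have cols: "T (i, j) < T (i', j)" if "(i', j) \<in> S" "i < i'" for i'
    using T b that unfolding ij standard_tableaux_def by blast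
  show ?thesis
    using b rows cols le unfolding ij outer_boxes_def by fastforce
qed

text \<open>The largest entry can be erased, and it can be put back because an outer box has nothing
  to its right or below it that the new entry would have to be smaller than.\<close>
lemma card_tableaux_largest_at:
  assumes S: "finite S" and b: "b \<in> outer_boxes S"
  shows "card {T \<in> standard_tableaux S. T b = card S} = card (standard_tableaux (S - {b}))"
proof -
  obtain i0 j0 where ij: "b = (i0, j0)" by force
  have bS: "b \<in> S" and brow: "\<And>j'. j0 < j' \<Longrightarrow> (i0, j') \<notin> S"
    and bcol: "\<And>i'. i0 < i' \<Longrightarrow> (i', j0) \<notin> S"
    using b unfolding ij outer_boxes_def by auto
  have cS: "card S = Suc (card (S - {b}))"
    using S bS by (metis card_Suc_Diff1)
  have split: "{1..card S} = insert (card S) {1..card (S - {b})}"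
    unfolding cS by auto
  let ?A = "{T \<in> standard_tableaux S. T b = card S}"
  let ?B = "standard_tableaux (S - {b})"
  have "bij_betw (\<lambda>T. restrict T (S - {b})) ?A ?B"
  proof (rule bij_betwI[where g = "\<lambda>T. T(b := card S)"])
    show "(\<lambda>T. restrict T (S - {b})) \<in> ?A \<rightarrow> ?B"
    proof
      fix T assume "T \<in> ?A"
      then have T: "T \<in> standard_tableaux S" and Tb: "T b = card S" by auto
      have "bij_betw T (S - {b}) ({1..card S} - {card S})"
        using standard_tableaux_bij[OF T] bS Tb
          inj_on_image_set_diff[of T S S "{b}"]
        by (auto simp: bij_betw_def inj_on_diff)
      also have "{1..card S} - {card S} = {1..card (S - {b})}"
        unfolding cS by auto
      finally have "bij_betw (restrict T (S - {b})) (S - {b}) {1..card (S - {b})}"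
        by (subst bij_betw_cong[of _ _ T]) auto
      then show "restrict T (S - {b}) \<in> ?B"
        using T unfolding standard_tableaux_def by (auto simp: restrict_def extensional_def)
    qed
    show "(\<lambda>T. T(b := card S)) \<in> ?B \<rightarrow> ?A"
    proof
      fix T assume T: "T \<in> ?B"
      have lt: "T c < card S" if "c \<in> S - {b}" for c
        using bij_betwE[OF standard_tableaux_bij[OF T]] that cS
        by (metis atLeastAtMost_iff le_imp_less_Suc)
      have "bij_betw (T(b := card S)) (S - {b}) {1..card (S - {b})}"
        using standard_tableaux_bij[OF T] by (subst bij_betw_cong[of _ _ T]) auto
      then have "bij_betw (T(b := card S)) (insert b (S - {b})) (insert (card S) {1..card (S - {b})})"
        using notIn_Un_bij_betw[of b "S - {b}" "T(b := card S)" "{1..card (S - {b})}"] cS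
        by simp
      then have bij: "bij_betw (T(b := card S)) S {1..card S}"
        unfolding split insert_Diff[OF bS] .
      have rows: "(T(b := card S)) (i, j) < (T(b := card S)) (i, j')"
        if "(i, j) \<in> S" "(i, j') \<in> S" "j < j'" for i j j'
      proof (cases "(i, j') = b")
        case True then show ?thesis using that lt by auto
      next
        case False
        moreover have "(i, j) \<noteq> b" using that brow ij by auto
        ultimately show ?thesis using T that unfolding standard_tableaux_def by auto
      qed
      have cols: "(T(b := card S)) (i, j) < (T(b := card S)) (i', j)"
        if "(i, j) \<in> S" "(i', j) \<in> S" "i < i'" for i i' j
      proof (cases "(i', j) = b")
        case True then show ?thesis using that lt by auto
      next
        case False
        moreover have "(i, j) \<noteq> b" using that bcol ij by auto
        ultimately show ?thesis using T that unfolding standard_tableaux_def by auto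
      qed
      have "T(b := card S) \<in> extensional S"
        using T bS unfolding standard_tableaux_def extensional_def by auto
      then have "T(b := card S) \<in> standard_tableaux S"
        by (rule standard_tableauxI[OF _ bij rows cols])
      then show "T(b := card S) \<in> ?A" by simp
    qed
    show "(restrict T (S - {b}))(b := card S) = T" if "T \<in> ?A" for T
      using that by (auto simp: standard_tableaux_def extensional_def restrict_def fun_eq_iff)
    show "restrict (T(b := card S)) (S - {b}) = T" if "T \<in> ?B" for T
      using that by (auto simp: standard_tableaux_def extensional_def restrict_def fun_eq_iff)
  qed
  then show ?thesis by (rule bij_betw_same_card)
qed

text \<open>Standard tableaux are sorted by the position of their largest entry, which is an outer box.\<close>
lemma card_standard_tableaux_branching:
  assumes S: "finite S" "S \<noteq> {}"
  shows "card (standard_tableaux S) = (\<Sum>b\<in>outer_boxes S. card (standard_tableaux (S - {b})))"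
proof -
  have fin: "finite (outer_boxes S)" and sub: "outer_boxes S \<subseteq> S"
    using S by (auto simp: outer_boxes_def intro: finite_subset[OF _ S(1)])
  have "\<exists>b\<in>outer_boxes S. T b = card S" if T: "T \<in> standard_tableaux S" for T
  proof -
    have "card S \<in> T ` S"
      using standard_tableaux_bij[OF T] S by (auto simp: bij_betw_def Suc_le_eq card_gt_0_iff)
    then show ?thesis using outer_box_of_largest_entry[OF T] by force
  qed
  then have "standard_tableaux S = (\<Union>b\<in>outer_boxes S. {T \<in> standard_tableaux S. T b = card S})"
    by auto
  also have "card \<dots> = (\<Sum>b\<in>outer_boxes S. card {T \<in> standard_tableaux S. T b = card S})"
  proof (rule card_UN_disjoint[OF fin])
    show "\<forall>b\<in>outer_boxes S. finite {T \<in> standard_tableaux S. T b = card S}"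
      using finite_standard_tableaux[OF S(1)] by simp
    have "b = b'" if "T \<in> standard_tableaux S" "T b = card S" "T b' = card S"
      "b \<in> outer_boxes S" "b' \<in> outer_boxes S" for T b b'
      using standard_tableaux_bij[OF that(1)] that sub
      by (metis bij_betw_imp_inj_on inj_onD subsetD)
    then show "\<forall>b\<in>outer_boxes S. \<forall>b'\<in>outer_boxes S. b \<noteq> b' \<longrightarrow>
        {T \<in> standard_tableaux S. T b = card S} \<inter> {T \<in> standard_tableaux S. T b' = card S} = {}"
      by blast
  qed
  also have "\<dots> = (\<Sum>b\<in>outer_boxes S. card (standard_tableaux (S - {b})))"
    by (rule sum.cong) (auto simp: card_tableaux_largest_at[OF S(1)])
  finally show ?thesis .
qed

lemma outer_boxes_nonempty:
  assumes "finite S" "S \<noteq> {}"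
  shows "outer_boxes S \<noteq> {}"
proof -
  \<comment> \<open>A box on the last occupied antidiagonal is outer.\<close>
  define w where "w b = fst b + snd b" for b :: "nat \<times> nat"
  have "Max (w ` S) \<in> w ` S" using assms by simp
  then obtain b where b: "b \<in> S" "w b = Max (w ` S)" by force
  then have le: "w c \<le> w b" if "c \<in> S" for c using that assms by simp
  have "b \<in> outer_boxes S"
    using b(1) le by (fastforce simp: outer_boxes_def w_def)
  then show ?thesis by auto
qed

text \<open>Positivity of \<open>dim \<nu>\<close> is what allows dividing by the limit of the normalised denominator.\<close>
lemma standard_tableaux_exist:
  assumes "finite S"
  shows "card (standard_tableaux S) > 0"
  using assms
proof (induction "card S" arbitrary: S)
  case 0
  then show ?case by (simp add: standard_tableaux_empty)
next
  case (Suc n)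
  then have ne: "S \<noteq> {}" by auto
  then obtain b where b: "b \<in> outer_boxes S" using outer_boxes_nonempty Suc.prems by blast
  then have "b \<in> S" by (auto simp: outer_boxes_def)
  then have pos: "0 < card (standard_tableaux (S - {b}))" using Suc by simp
  have "finite (outer_boxes S)" using Suc.prems
    by (rule rev_finite_subset) (auto simp: outer_boxes_def)
  then show ?case
    unfolding card_standard_tableaux_branching[OF Suc.prems ne]
    using b pos by (metis sum_pos2 zero_le)
qed

section \<open>Chains of horizontal strips\<close>

text \<open>From here on a shape is a weakly decreasing function of the row number, zero from some row on.
  This drops the length of a signature, so that shapes at different levels have one type.\<close>
definition cells :: "(nat \<Rightarrow> nat) \<Rightarrow> (nat \<times> nat) set" where
  "cells q = {(i, j). j < q i}"

definition hstrip :: "(nat \<Rightarrow> nat) \<Rightarrow> (nat \<Rightarrow> nat) \<Rightarrow> bool" where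
  "hstrip p q \<longleftrightarrow> (\<forall>i. q (Suc i) \<le> p i \<and> p i \<le> q i)"

lemma cells_subset_iff: "cells p \<subseteq> cells q \<longleftrightarrow> p \<le> q"
proof
  assume L: "cells p \<subseteq> cells q"
  show "p \<le> q"
  proof (rule le_funI, rule ccontr)
    fix i assume "\<not> p i \<le> q i"
    then have "(i, q i) \<in> cells p" by (simp add: cells_def)
    then show False using L by (auto simp: cells_def)
  qed
qed (auto simp: cells_def le_fun_def intro: less_le_trans)

lemma cells_inject: "cells p = cells q \<longleftrightarrow> p = q"
  using cells_subset_iff[of p q] cells_subset_iff[of q p] by auto

lemma hstrip_le: "hstrip p q \<Longrightarrow> p \<le> q"
  by (simp add: hstrip_def le_fun_def)

lemma hstrip_antimono: "hstrip p q \<Longrightarrow> antimono p"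
  unfolding antimono_iff_le_Suc hstrip_def by (meson order_trans)

lemma hstrip_refl: "antimono q \<Longrightarrow> hstrip q q"
  by (simp add: hstrip_def antimono_iff_le_Suc)

lemma finite_cells_mono: "p \<le> q \<Longrightarrow> finite (cells q) \<Longrightarrow> finite (cells p)"
  using cells_subset_iff finite_subset by blast

lemma finite_hstrips:
  assumes "finite (cells q)"
  shows "finite {r. hstrip r q}"
proof (rule finite_imageD)
  have "cells ` {r. hstrip r q} \<subseteq> Pow (cells q)"
    using hstrip_le cells_subset_iff by blast
  then show "finite (cells ` {r. hstrip r q})"
    using assms by (meson finite_Pow_iff finite_subset)
qed (auto simp: inj_on_def cells_inject)

text \<open>The recursion removes the last strip: the first shape \<open>p\<close> stays fixed, as it does both when the
  last vertex of a path and when the largest entry of a tableau is removed.\<close>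
primrec strip_chains :: "nat \<Rightarrow> (nat \<Rightarrow> nat) \<Rightarrow> (nat \<Rightarrow> nat) \<Rightarrow> nat" where
  "strip_chains 0 p q = (if p = q then 1 else 0)"
| "strip_chains (Suc k) p q = (\<Sum>r | hstrip r q. strip_chains k p r)"

primrec proper_strip_chains :: "nat \<Rightarrow> (nat \<Rightarrow> nat) \<Rightarrow> (nat \<Rightarrow> nat) \<Rightarrow> nat" where
  "proper_strip_chains 0 p q = (if p = q then 1 else 0)"
| "proper_strip_chains (Suc k) p q = (\<Sum>r | hstrip r q \<and> r \<noteq> q. proper_strip_chains k p r)"

text \<open>The binomial coefficient chooses the steps at which the shape changes. In the induction the
  last strip is either empty or not, and the two cases are the two terms of Pascal's rule.\<close>
lemma strip_chains_binomial:
  assumes "antimono q" "finite (cells q)"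
  shows "strip_chains k p q = (\<Sum>j\<le>k. (k choose j) * proper_strip_chains j p q)"
  using assms
proof (induction k arbitrary: q)
  case 0
  then show ?case by simp
next
  case (Suc k)
  let ?R = "{r. hstrip r q \<and> r \<noteq> q}"
  have fin: "finite ?R" using finite_hstrips[OF Suc.prems(2)] by (rule rev_finite_subset) auto
  have set: "{r. hstrip r q} = insert q ?R" using hstrip_refl[OF Suc.prems(1)] by auto
  have "strip_chains (Suc k) p q = strip_chains k p q + (\<Sum>r\<in>?R. strip_chains k p r)"
    unfolding strip_chains.simps set using fin by (subst sum.insert) auto
  also have "(\<Sum>r\<in>?R. strip_chains k p r)
      = (\<Sum>r\<in>?R. \<Sum>j\<le>k. (k choose j) * proper_strip_chains j p r)"
    by (rule sum.cong[OF refl], rule Suc.IH)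
      (use hstrip_antimono hstrip_le finite_cells_mono Suc.prems in blast)+
  also have "\<dots> = (\<Sum>j\<le>k. (k choose j) * proper_strip_chains (Suc j) p q)"
    by (subst sum.swap) (simp add: sum_distrib_left)
  also have "strip_chains k p q = proper_strip_chains 0 p q
      + (\<Sum>j\<le>k. (k choose Suc j) * proper_strip_chains (Suc j) p q)"
  proof -
    have "strip_chains k p q = (\<Sum>j\<le>Suc k. (k choose j) * proper_strip_chains j p q)"
      using Suc.IH[OF Suc.prems] by simp
    also have "\<dots> = proper_strip_chains 0 p q
        + (\<Sum>j\<le>k. (k choose Suc j) * proper_strip_chains (Suc j) p q)"
      by (subst sum.atMost_Suc_shift) simp
    finally show ?thesis .
  qed
  also have "proper_strip_chains 0 p q
      + (\<Sum>j\<le>k. (k choose Suc j) * proper_strip_chains (Suc j) p q)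
      + (\<Sum>j\<le>k. (k choose j) * proper_strip_chains (Suc j) p q)
      = (\<Sum>j\<le>Suc k. (Suc k choose j) * proper_strip_chains j p q)"
    by (subst sum.atMost_Suc_shift) (simp add: sum.distrib[symmetric] algebra_simps)
  finally show ?case .
qed

lemma proper_strip_chains_nonzero:
  assumes "proper_strip_chains j p q \<noteq> 0" "finite (cells q)"
  shows "p \<le> q" and "card (cells p) + j \<le> card (cells q)"
proof -
  have "p \<le> q \<and> card (cells p) + j \<le> card (cells q)"
    using assms
  proof (induction j arbitrary: q)
    case 0
    then show ?case by (auto split: if_splits)
  next
    case (Suc j)
    then have "(\<Sum>r | hstrip r q \<and> r \<noteq> q. proper_strip_chains j p r) \<noteq> 0" by simp
    then obtain r where r: "hstrip r q" "r \<noteq> q" "proper_strip_chains j p r \<noteq> 0"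
      by (rule sum.not_neutral_contains_not_neutral) auto
    have "r \<le> q" using r hstrip_le by blast
    then have "cells r \<subset> cells q"
      using r(2) cells_subset_iff[of r q] cells_inject[of r q] by auto
    then have "card (cells r) < card (cells q)" using Suc.prems by (simp add: psubset_card_mono)
    moreover have "p \<le> r \<and> card (cells p) + j \<le> card (cells r)"
      using Suc.IH r(3) finite_cells_mono[OF \<open>r \<le> q\<close>] Suc.prems by blast
    ultimately show ?case using \<open>r \<le> q\<close> by auto
  qed
  then show "p \<le> q" and "card (cells p) + j \<le> card (cells q)" by auto
qed

lemma cells_remove_box:
  assumes "0 < q i"
  shows "cells (q(i := q i - 1)) = cells q - {(i, q i - 1)}"
  using assms by (auto simp: cells_def split: if_splits)

text \<open>An outer box is the last of its row and has nothing below it in \<open>q\<close>. The box below it cannot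
  be missing merely because it lies in \<open>p\<close>, since \<open>p\<close> would then contain the outer box as well.\<close>
lemma outer_boxes_skew:
  assumes p: "antimono p" and q: "antimono q"
  shows "outer_boxes (cells q - cells p)
    = (\<lambda>i. (i, q i - 1)) ` {i. q (Suc i) < q i \<and> p i < q i}" (is "?L = ?R")
proof
  show "?L \<subseteq> ?R"
  proof
    fix b assume b: "b \<in> ?L"
    obtain i j where ij: "b = (i, j)" by force
    have in1: "j < q i" "p i \<le> j" using b unfolding ij outer_boxes_def cells_def by auto
    have "(i, Suc j) \<notin> cells q - cells p" "(Suc i, j) \<notin> cells q - cells p"
      using b unfolding ij outer_boxes_def by auto
    then have "\<not> Suc j < q i" "\<not> j < q (Suc i)"
      using in1 antimonoD[OF p, of i "Suc i"] by (auto simp: cells_def)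
    then show "b \<in> ?R" using in1 unfolding ij by (auto intro!: image_eqI[of _ _ i])
  qed
  show "?R \<subseteq> ?L"
  proof
    fix b assume "b \<in> ?R"
    then obtain i where i: "b = (i, q i - 1)" "q (Suc i) < q i" "p i < q i" by auto
    have "\<not> q i - 1 < q i'" if "i < i'" for i'
      using antimonoD[OF q, of "Suc i" i'] that i(2) by auto
    then show "b \<in> ?L" using i unfolding outer_boxes_def cells_def by fastforce
  qed
qed

lemma hstrip_codim_one:
  assumes r: "hstrip r q" "r \<noteq> q" and q: "finite (cells q)"
    and card: "card (cells q) \<le> Suc (card (cells r))"
  obtains i where "q (Suc i) < q i" "r i < q i" "r = q(i := q i - 1)"
proof -
  obtain i where i: "r i < q i"
    using r hstrip_le[OF r(1)] by (metis ext le_funD le_neq_implies_less)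
  have "r \<le> q(i := q i - 1)" using i hstrip_le[OF r(1)] by (auto simp: le_fun_def)
  then have sub: "cells r \<subseteq> cells (q(i := q i - 1))" by (simp add: cells_subset_iff)
  have rem: "cells (q(i := q i - 1)) = cells q - {(i, q i - 1)}"
    using i by (intro cells_remove_box) simp
  have "(i, q i - 1) \<in> cells q" using i by (simp add: cells_def)
  then have "card (cells (q(i := q i - 1))) \<le> card (cells r)"
    unfolding rem using card q by simp
  then have "r = q(i := q i - 1)"
    using card_seteq[OF _ sub] q rem cells_inject by (metis finite_Diff)
  moreover have "q (Suc i) < q i" using r(1) i unfolding hstrip_def by (meson le_less_trans)
  ultimately show ?thesis using i that by blast
qed

text \<open>With as many nonempty strips as boxes, every strip is a single box. Removing the last strip is
  then removing an outer box, and the recursion becomes the branching rule of standard tableaux.\<close>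
lemma proper_strip_chains_maximal:
  assumes "antimono p" "antimono q" "finite (cells q)" "p \<le> q"
    and "card (cells q) = card (cells p) + d"
  shows "proper_strip_chains d p q = card (standard_tableaux (cells q - cells p))"
  using assms
proof (induction d arbitrary: q)
  case 0
  have "cells p = cells q"
    using card_seteq[OF \<open>finite (cells q)\<close>, of "cells p"] 0 by (simp add: cells_subset_iff)
  then show ?case by (simp add: cells_inject standard_tableaux_empty)
next
  case (Suc d)
  note p = Suc.prems(1) and q = Suc.prems(2) and fin = Suc.prems(3) and pq = Suc.prems(4)
  let ?S = "cells q - cells p"
  let ?I = "{i. q (Suc i) < q i \<and> p i < q i}"
  let ?low = "\<lambda>i. q(i := q i - 1)"
  have low_strip: "hstrip (?low i) q" and low_neq: "?low i \<noteq> q" and low_ge: "p \<le> ?low i"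
    and low_card: "card (cells (?low i)) = card (cells p) + d"
    and low_cells: "cells (?low i) - cells p = ?S - {(i, q i - 1)}" if i: "i \<in> ?I" for i
  proof -
    show "hstrip (?low i) q"
      using i antimonoD[OF q, of "k" "Suc k" for k] by (auto simp: hstrip_def)
    show "?low i \<noteq> q" using i by (auto simp: fun_eq_iff)
    show "p \<le> ?low i" using i pq by (auto simp: le_fun_def)
    have rem: "cells (?low i) = cells q - {(i, q i - 1)}" using i by (intro cells_remove_box) simp
    show "cells (?low i) - cells p = ?S - {(i, q i - 1)}" unfolding rem by auto
    have "(i, q i - 1) \<in> cells q" using i by (auto simp: cells_def)
    then show "card (cells (?low i)) = card (cells p) + d"
      unfolding rem using Suc.prems(5) fin by simp
  qed
  have inj: "inj_on ?low ?I"
  proof (rule inj_onI)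
    fix i i' assume "i \<in> ?I" "i' \<in> ?I" "?low i = ?low i'"
    then show "i = i'" by (cases "i = i'") (auto dest!: fun_cong[of _ _ i])
  qed
  have "proper_strip_chains (Suc d) p q
      = (\<Sum>r | hstrip r q \<and> r \<noteq> q. proper_strip_chains d p r)" by simp
  \<comment> \<open>A last strip of more than one box leaves too few boxes for \<open>d\<close> nonempty strips.\<close>
  also have "\<dots> = (\<Sum>r\<in>?low ` ?I. proper_strip_chains d p r)"
  proof (rule sum.mono_neutral_right)
    show "finite {r. hstrip r q \<and> r \<noteq> q}"
      using finite_hstrips[OF fin] by (rule rev_finite_subset) auto
    show "?low ` ?I \<subseteq> {r. hstrip r q \<and> r \<noteq> q}"
      by (intro image_subsetI CollectI conjI) (rule low_strip low_neq, assumption)+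
    show "\<forall>r\<in>{r. hstrip r q \<and> r \<noteq> q} - ?low ` ?I. proper_strip_chains d p r = 0"
    proof (rule ballI, rule ccontr)
      fix r assume r: "r \<in> {r. hstrip r q \<and> r \<noteq> q} - ?low ` ?I"
        and nz: "proper_strip_chains d p r \<noteq> 0"
      have "finite (cells r)" using r hstrip_le finite_cells_mono fin by blast
      note pr = proper_strip_chains_nonzero[OF nz this]
      have "card (cells q) \<le> Suc (card (cells r))" using pr(2) Suc.prems(5) by simp
      then obtain i where i: "q (Suc i) < q i" "r i < q i" "r = ?low i"
        using hstrip_codim_one[OF _ _ fin] r by blast
      have "p i < q i" using le_funD[OF pr(1), of i] i(2) by linarith
      then show False using i r by blast
    qed
  qed
  also have "\<dots> = (\<Sum>i\<in>?I. proper_strip_chains d p (?low i))"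
    by (rule sum.reindex_cong[OF inj]) auto
  also have "\<dots> = (\<Sum>i\<in>?I. card (standard_tableaux (?S - {(i, q i - 1)})))"
  proof (rule sum.cong[OF refl])
    fix i assume i: "i \<in> ?I"
    show "proper_strip_chains d p (?low i) = card (standard_tableaux (?S - {(i, q i - 1)}))"
      using Suc.IH[OF p hstrip_antimono[OF low_strip[OF i]]
          finite_cells_mono[OF hstrip_le[OF low_strip[OF i]] fin] low_ge[OF i] low_card[OF i]]
      by (simp only: low_cells[OF i])
  qed
  also have "\<dots> = (\<Sum>b\<in>outer_boxes ?S. card (standard_tableaux (?S - {b})))"
    unfolding outer_boxes_skew[OF p q] by (subst sum.reindex) (auto simp: inj_on_def)
  also have "\<dots> = card (standard_tableaux ?S)"
  proof (rule card_standard_tableaux_branching[symmetric])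
    show "finite ?S" using fin by simp
    show "?S \<noteq> {}"
    proof
      assume "?S = {}"
      then have "cells q = cells p" using pq cells_subset_iff[of p q] by auto
      then show False using Suc.prems(5) by simp
    qed
  qed
  finally show ?case .
qed

section \<open>Growth of the number of chains\<close>

lemma binomial_over_power_tendsto:
  "(\<lambda>k. real (k choose j) / real k ^ j) \<longlonglongrightarrow> 1 / fact j"
proof (induction j)
  case 0
  then show ?case by simp
next
  case (Suc j)
  have "(\<lambda>k. real (k choose j) / real k ^ j * ((1 - real j / real k) / real (Suc j)))
      \<longlonglongrightarrow> 1 / fact j * ((1 - 0) / real (Suc j))"
    by (intro tendsto_intros Suc.IH lim_const_over_n) auto
  also have "1 / fact j * ((1 - 0) / real (Suc j)) = (1 / fact (Suc j) :: real)"
    by (simp add: field_simps)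
  finally show ?case
  proof (rule Lim_transform_eventually)
    show "\<forall>\<^sub>F k in sequentially. real (k choose j) / real k ^ j * ((1 - real j / real k) / real (Suc j))
        = real (k choose Suc j) / real k ^ Suc j"
    proof (rule eventually_sequentiallyI[of "Suc j"])
      fix k assume k: "Suc j \<le> k"
      have "real (Suc j) * real (k choose Suc j) = real (k - j) * real (k choose j)"
        using binomial_absorb_comp[of k j] Suc_times_binomial_eq[of "k - 1" j] k
          binomial_absorption[of j k] by (metis of_nat_mult)
      then have "real (k choose Suc j) = (real k - real j) * real (k choose j) / real (Suc j)"
        using k by (simp add: of_nat_diff field_simps)
      moreover have "1 - real j / real k = (real k - real j) / real k"
        using k by (simp add: field_simps)
      ultimately show "real (k choose j) / real k ^ j * ((1 - real j / real k) / real (Suc j))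
          = real (k choose Suc j) / real k ^ Suc j"
        by (simp add: mult_ac)
    qed
  qed
qed

lemma binomial_over_larger_power_tendsto:
  assumes "j < d"
  shows "(\<lambda>k. real (k choose j) / real k ^ d) \<longlonglongrightarrow> 0"
proof -
  have "(\<lambda>k. real (k choose j) / real k ^ j * (1 / real k) ^ (d - j)) \<longlonglongrightarrow> 1 / fact j * 0 ^ (d - j)"
    by (intro tendsto_intros binomial_over_power_tendsto lim_const_over_n)
  moreover have "real (k choose j) / real k ^ j * (1 / real k) ^ (d - j)
      = real (k choose j) / real k ^ d" for k
    using assms by (simp add: power_divide flip: power_add)
  ultimately show ?thesis using assms by (simp add: power_0_left)
qed

lemma strip_chains_asymptotics:
  assumes "antimono p" "antimono q" "finite (cells q)" "p \<le> q"
    and d: "card (cells q) = card (cells p) + d"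
  shows "(\<lambda>k. real (strip_chains k p q) / real k ^ d)
    \<longlonglongrightarrow> real (card (standard_tableaux (cells q - cells p))) / fact d"
proof -
  have exp: "strip_chains k p q = (\<Sum>j\<le>d. (k choose j) * proper_strip_chains j p q)" for k
  proof -
    have z: "proper_strip_chains j p q = 0" if "d < j" for j
      using proper_strip_chains_nonzero(2)[of j p q] assms that by (metis not_le nat_add_left_cancel_le)
    have "strip_chains k p q = (\<Sum>j\<le>k. (k choose j) * proper_strip_chains j p q)"
      using strip_chains_binomial assms by blast
    also have "\<dots> = (\<Sum>j\<le>max k d. (k choose j) * proper_strip_chains j p q)"
      by (rule sum.mono_neutral_left) (auto simp: binomial_eq_0)
    also have "\<dots> = (\<Sum>j\<le>d. (k choose j) * proper_strip_chains j p q)"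
      by (rule sum.mono_neutral_right) (auto simp: z)
    finally show ?thesis .
  qed
  have "(\<lambda>k. \<Sum>j\<le>d. real (proper_strip_chains j p q) * (real (k choose j) / real k ^ d))
    \<longlonglongrightarrow> (\<Sum>j\<le>d. real (proper_strip_chains j p q) * (if j = d then 1 / fact d else 0))"
    by (intro tendsto_intros) (use binomial_over_power_tendsto binomial_over_larger_power_tendsto
        in \<open>auto simp: le_less\<close>)
  also have "(\<Sum>j\<le>d. real (proper_strip_chains j p q) * (if j = d then 1 / fact d else 0))
      = real (proper_strip_chains d p q) / fact d"
    by (simp add: if_distrib cong: if_cong)
  also have "proper_strip_chains d p q = card (standard_tableaux (cells q - cells p))"
    by (rule proper_strip_chains_maximal) (use assms in auto)
  finally show ?thesis
    by (simp add: exp sum_divide_distrib mult.commute)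
qed

section \<open>Paths in the Gelfand-Tsetlin graph as chains of strips\<close>

definition rows :: "int list \<Rightarrow> nat \<Rightarrow> nat" where
  "rows l i = (if i < length l then nat (l ! i) else 0)"

text \<open>If the end of a path is nonnegative then so is the whole path, by interlacing; this is why
  only these signatures occur below a Young diagram.\<close>
definition nonneg_GT :: "nat \<Rightarrow> int list set" where
  "nonneg_GT N = {l \<in> GT N. \<forall>x\<in>set l. 0 \<le> x}"

lemma rows_inject: "l \<in> nonneg_GT N \<Longrightarrow> l' \<in> nonneg_GT N \<Longrightarrow> rows l = rows l' \<longleftrightarrow> l = l'"
  by (auto simp: nonneg_GT_def GT_def rows_def fun_eq_iff intro!: nth_equalityI)
    (metis eq_nat_nat_iff nth_mem)

lemma finite_cells_rows: "finite (cells (rows l))"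
proof (rule finite_subset)
  show "cells (rows l) \<subseteq> (SIGMA i:{..<length l}. {..<rows l i})"
    by (auto simp: cells_def rows_def split: if_splits)
qed auto

lemma interlaces_nonneg:
  assumes "\<nu> \<in> nonneg_GT (Suc N)" "\<kappa> \<in> GT N" "interlaces \<kappa> \<nu>"
  shows "\<kappa> \<in> nonneg_GT N"
  using assms unfolding nonneg_GT_def GT_def interlaces_def
  by (auto simp: in_set_conv_nth) (metis Suc_mono nth_mem order_trans)

lemma interlaces_iff_hstrip:
  assumes "\<nu> \<in> nonneg_GT (Suc N)" "\<kappa> \<in> nonneg_GT N"
  shows "interlaces \<kappa> \<nu> \<longleftrightarrow> hstrip (rows \<kappa>) (rows \<nu>)"
proof -
  have len: "length \<nu> = Suc N" "length \<kappa> = N" using assms by (auto simp: nonneg_GT_def GT_def)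
  have nn: "0 \<le> \<nu> ! i" if "i \<le> N" for i using assms that len by (auto simp: nonneg_GT_def)
  have nl: "0 \<le> \<kappa> ! i" if "i < N" for i using assms that len by (auto simp: nonneg_GT_def)
  have "hstrip (rows \<kappa>) (rows \<nu>)
      \<longleftrightarrow> (\<forall>i<N. nat (\<nu> ! Suc i) \<le> nat (\<kappa> ! i) \<and> nat (\<kappa> ! i) \<le> nat (\<nu> ! i))"
    unfolding hstrip_def rows_def len by (intro iff_allI) auto
  also have "\<dots> \<longleftrightarrow> interlaces \<kappa> \<nu>"
    unfolding interlaces_def len using nn nl by (auto simp: nat_le_eq_zle)
  finally show ?thesis by simp
qed

text \<open>The condition \<open>r N = 0\<close> is the length restriction: removing a strip from a shape with
  \<open>N + 1\<close> rows can leave a shape with \<open>N + 1\<close> rows, which is no signature of level \<open>N\<close>.\<close>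
lemma bij_betw_interlacing_hstrips:
  assumes \<nu>: "\<nu> \<in> nonneg_GT (Suc N)"
  shows "bij_betw rows {\<kappa> \<in> GT N. interlaces \<kappa> \<nu>} {r. hstrip r (rows \<nu>) \<and> r N = 0}"
proof -
  have pos: "\<kappa> \<in> nonneg_GT N" if "\<kappa> \<in> GT N" "interlaces \<kappa> \<nu>" for \<kappa>
    using interlaces_nonneg[OF \<nu>] that by blast
  have "inj_on rows {\<kappa> \<in> GT N. interlaces \<kappa> \<nu>}"
    by (rule inj_onI) (metis (mono_tags, lifting) mem_Collect_eq pos rows_inject)
  moreover have "rows ` {\<kappa> \<in> GT N. interlaces \<kappa> \<nu>} = {r. hstrip r (rows \<nu>) \<and> r N = 0}" (is "?L = ?R")
  proof
    show "?L \<subseteq> ?R"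
      using pos interlaces_iff_hstrip[OF \<nu>] by (auto simp: rows_def GT_def)
    show "?R \<subseteq> ?L"
    proof
      fix r assume "r \<in> ?R"
      then have r: "hstrip r (rows \<nu>)" "r N = 0" by auto
      let ?l = "map (\<lambda>i. int (r i)) [0..<N]"
      have anti: "antimono r" using hstrip_antimono r by blast
      have rl: "rows ?l = r"
        using antimonoD[OF anti, of N] r(2) by (auto simp: rows_def fun_eq_iff)
      have lpos: "?l \<in> nonneg_GT N"
        using antimonoD[OF anti] by (auto simp: nonneg_GT_def GT_def sorted_wrt_iff_nth_less)
      then have "interlaces ?l \<nu>" using interlaces_iff_hstrip[OF \<nu> lpos] r rl by simp
      then show "r \<in> ?L" using lpos rl by (force simp: nonneg_GT_def)
    qed
  qed
  ultimately show ?thesis by (simp add: bij_betw_def)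
qed

text \<open>The start is only required to lie in a set \<open>A\<close>, since \<open>GT_Dim\<close> leaves it free.\<close>
definition paths_from_to :: "int list set \<Rightarrow> nat \<Rightarrow> nat \<Rightarrow> int list \<Rightarrow> (nat \<Rightarrow> int list) set" where
  "paths_from_to A N M \<nu> = {l \<in> GT_paths N M. l N \<in> A \<and> l M = \<nu>}"

lemma card_paths_trivial:
  assumes "\<nu> \<in> GT N"
  shows "finite (paths_from_to A N N \<nu>)"
    and "card (paths_from_to A N N \<nu>) = (if \<nu> \<in> A then 1 else 0)"
proof -
  have "paths_from_to A N N \<nu> = (if \<nu> \<in> A then {(\<lambda>i\<in>{N}. \<nu>)} else {})"
    using assms by (auto simp: paths_from_to_def GT_paths_def PiE_def extensional_def fun_eq_iff)
  then show "finite (paths_from_to A N N \<nu>)"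
    and "card (paths_from_to A N N \<nu>) = (if \<nu> \<in> A then 1 else 0)" by auto
qed

lemma paths_last_step:
  assumes "N \<le> M" "\<nu> \<in> GT (Suc M)"
  shows "paths_from_to A N (Suc M) \<nu>
    = (\<Union>\<kappa>\<in>{\<kappa> \<in> GT M. interlaces \<kappa> \<nu>}. (\<lambda>l. l(Suc M := \<nu>)) ` paths_from_to A N M \<kappa>)"
    (is "?L = ?R")
proof
  have iv: "{N..Suc M} = insert (Suc M) {N..M}" and ivl: "{N..<Suc M} = insert M {N..<M}"
    using assms(1) by auto
  show "?L \<subseteq> ?R"
  proof
    fix l assume l: "l \<in> ?L"
    let ?l = "restrict l {N..M}"
    have "l M \<in> GT M" "interlaces (l M) \<nu>"
      using l assms(1) unfolding paths_from_to_def GT_paths_def iv ivl by auto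
    moreover have "?l \<in> paths_from_to A N M (l M)"
      using l assms(1) unfolding paths_from_to_def GT_paths_def iv ivl by auto
    moreover have "l = ?l(Suc M := \<nu>)"
      using l unfolding paths_from_to_def GT_paths_def iv
      by (auto simp: fun_eq_iff restrict_def PiE_def extensional_def)
    ultimately show "l \<in> ?R" by blast
  qed
  show "?R \<subseteq> ?L"
  proof
    fix l assume "l \<in> ?R"
    then obtain \<kappa> k where k: "\<kappa> \<in> GT M" "interlaces \<kappa> \<nu>" "k \<in> paths_from_to A N M \<kappa>"
      "l = k(Suc M := \<nu>)" by blast
    then show "l \<in> ?L"
      using assms unfolding paths_from_to_def GT_paths_def iv ivl
      by (auto simp: PiE_def extensional_def)
  qed
qed

lemma inj_on_extend_paths: "inj_on (\<lambda>l. l(Suc M := \<nu>)) (paths_from_to A N M \<kappa>)"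
proof (rule inj_onI)
  fix k l assume "k \<in> paths_from_to A N M \<kappa>" "l \<in> paths_from_to A N M \<kappa>"
    and eq: "k(Suc M := \<nu>) = l(Suc M := \<nu>)"
  then have "k (Suc M) = l (Suc M)"
    by (auto simp: paths_from_to_def GT_paths_def PiE_def extensional_def)
  then show "k = l" using eq by (metis fun_upd_triv fun_upd_upd)
qed

text \<open>A strip adds at most one new row. Hence the bound on the number of parts of a signature of
  level \<open>N\<close> holds automatically along a chain that satisfies it at the start.\<close>
lemma strip_chains_length:
  assumes "strip_chains k p q \<noteq> 0" "\<And>i. b \<le> i \<Longrightarrow> p i = 0"
  shows "b + k \<le> i \<Longrightarrow> q i = 0"
  using assms(1)
proof (induction k arbitrary: q i)
  case 0
  then show ?case using assms(2) by (auto split: if_splits)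
next
  case (Suc k)
  then have "(\<Sum>r | hstrip r q. strip_chains k p r) \<noteq> 0" by simp
  then obtain r where r: "hstrip r q" "strip_chains k p r \<noteq> 0"
    by (rule sum.not_neutral_contains_not_neutral) auto
  obtain i' where i': "i = Suc i'" "b + k \<le> i'" using Suc.prems by (cases i) auto
  have "r i' = 0" using Suc.IH[OF i'(2) r(2)] .
  then show ?case using r(1) i' by (metis hstrip_def le_zero_eq)
qed

text \<open>Both dimensions are instances: \<open>k = 0\<close> and \<open>A = {\<mu>}\<close> for paths from a fixed signature,
  and \<open>k = 1\<close>, \<open>N = 1\<close>, \<open>A = UNIV\<close> for paths from level 1. In the latter case the arbitrary
  starting row counts as one strip added to the empty shape.\<close>
lemma card_paths_eq_strip_chains:
  assumes k: "k \<le> N" and p: "\<And>i. N - k \<le> i \<Longrightarrow> p i = 0"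
    and base: "\<And>\<nu>. \<nu> \<in> nonneg_GT N \<Longrightarrow> strip_chains k p (rows \<nu>) = (if \<nu> \<in> A then 1 else 0)"
    and "\<nu> \<in> nonneg_GT (N + t)"
  shows "finite (paths_from_to A N (N + t) \<nu>)
    \<and> card (paths_from_to A N (N + t) \<nu>) = strip_chains (k + t) p (rows \<nu>)"
  using assms(4)
proof (induction t arbitrary: \<nu>)
  case 0
  then have "\<nu> \<in> GT N" by (simp add: nonneg_GT_def)
  then show ?case using card_paths_trivial[of \<nu> N A] base 0 by simp
next
  case (Suc t)
  let ?M = "N + t"
  let ?I = "{\<kappa> \<in> GT ?M. interlaces \<kappa> \<nu>}"
  have \<nu>: "\<nu> \<in> nonneg_GT (Suc ?M)" and \<nu>': "\<nu> \<in> GT (Suc ?M)" using Suc.prems by (auto simp: nonneg_GT_def)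
  have fin_hs: "finite {r. hstrip r (rows \<nu>)}"
    by (intro finite_hstrips finite_cells_rows)
  note bij = bij_betw_interlacing_hstrips[OF \<nu>]
  have finI: "finite ?I"
    using bij_betw_finite[OF bij] fin_hs by (simp add: rev_finite_subset[OF fin_hs] Collect_mono)
  have IH: "finite (paths_from_to A N ?M \<kappa>)"
    "card (paths_from_to A N ?M \<kappa>) = strip_chains (k + t) p (rows \<kappa>)" if "\<kappa> \<in> ?I" for \<kappa>
    using Suc.IH interlaces_nonneg[OF \<nu>] that by blast+
  let ?E = "\<lambda>\<kappa>. (\<lambda>l. l(Suc ?M := \<nu>)) ` paths_from_to A N ?M \<kappa>"
  have eq: "paths_from_to A N (N + Suc t) \<nu> = (\<Union>\<kappa>\<in>?I. ?E \<kappa>)"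
    using paths_last_step[OF _ \<nu>', of N A] by simp
  have fin: "finite (paths_from_to A N (N + Suc t) \<nu>)"
    unfolding eq using finI IH(1) by blast
  have "card (paths_from_to A N (N + Suc t) \<nu>) = (\<Sum>\<kappa>\<in>?I. card (?E \<kappa>))"
    unfolding eq
  proof (rule card_UN_disjoint[OF finI])
    show "\<forall>\<kappa>\<in>?I. finite (?E \<kappa>)" using IH(1) by blast
    have "\<kappa> = \<kappa>'" if "l \<in> ?E \<kappa>" "l \<in> ?E \<kappa>'" for l \<kappa> \<kappa>'
    proof -
      have "l ?M = \<kappa>" using that(1) by (auto simp: paths_from_to_def)
      moreover have "l ?M = \<kappa>'" using that(2) by (auto simp: paths_from_to_def)
      ultimately show ?thesis by simp
    qed
    then show "\<forall>\<kappa>\<in>?I. \<forall>\<kappa>'\<in>?I. \<kappa> \<noteq> \<kappa>' \<longrightarrow> ?E \<kappa> \<inter> ?E \<kappa>' = {}" by blast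
  qed
  also have "\<dots> = (\<Sum>\<kappa>\<in>?I. strip_chains (k + t) p (rows \<kappa>))"
    by (rule sum.cong[OF refl]) (metis IH(2) card_image inj_on_extend_paths)
  also have "\<dots> = (\<Sum>r | hstrip r (rows \<nu>) \<and> r ?M = 0. strip_chains (k + t) p r)"
    by (rule sum.reindex_bij_betw[OF bij])
  also have "\<dots> = (\<Sum>r | hstrip r (rows \<nu>). strip_chains (k + t) p r)"
  proof (rule sum.mono_neutral_left[OF fin_hs])
    have "r ?M = 0" if "strip_chains (k + t) p r \<noteq> 0" for r
      using strip_chains_length[OF that, of "N - k" ?M] p k by simp
    then show "\<forall>r\<in>{r. hstrip r (rows \<nu>)} - {r. hstrip r (rows \<nu>) \<and> r ?M = 0}.
        strip_chains (k + t) p r = 0" by blast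
  qed auto
  finally show ?case using fin by simp
qed

lemma GT_Dim_between_eq_strip_chains:
  assumes "N \<le> M" "\<mu> \<in> nonneg_GT N" "\<nu> \<in> nonneg_GT M"
  shows "GT_Dim_between N \<mu> M \<nu> = strip_chains (M - N) (rows \<mu>) (rows \<nu>)"
proof -
  have "GT_Dim_between N \<mu> M \<nu> = card (paths_from_to {\<mu>} N (N + (M - N)) \<nu>)"
    using assms(1) by (simp add: GT_Dim_between_def paths_from_to_def)
  also have "\<dots> = strip_chains (0 + (M - N)) (rows \<mu>) (rows \<nu>)"
    by (rule card_paths_eq_strip_chains[THEN conjunct2])
      (use assms rows_inject[OF assms(2)] in \<open>auto simp: rows_def nonneg_GT_def GT_def\<close>)
  finally show ?thesis by simp
qed

lemma GT_Dim_eq_strip_chains: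
  assumes "0 < N" "\<nu> \<in> nonneg_GT N"
  shows "GT_Dim N \<nu> = strip_chains N (\<lambda>_. 0) (rows \<nu>)"
proof -
  have "GT_Dim N \<nu> = card (paths_from_to UNIV 1 (1 + (N - 1)) \<nu>)"
    using assms(1) by (simp add: GT_Dim_def paths_from_to_def)
  also have "\<dots> = strip_chains (1 + (N - 1)) (\<lambda>_. 0) (rows \<nu>)"
  proof (rule card_paths_eq_strip_chains[THEN conjunct2])
    fix \<kappa> assume "\<kappa> \<in> nonneg_GT 1"
    then have "hstrip (\<lambda>_. 0) (rows \<kappa>)" by (auto simp: hstrip_def rows_def nonneg_GT_def GT_def)
    then show "strip_chains 1 (\<lambda>_. 0) (rows \<kappa>) = (if \<kappa> \<in> UNIV then 1 else 0)"
      using finite_hstrips[OF finite_cells_rows, of \<kappa>] by (simp add: sum.delta)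
  qed (use assms in auto)
  finally show ?thesis using assms(1) by simp
qed

section \<open>The limit of the links\<close>

definition row_fun :: "nat list \<Rightarrow> nat \<Rightarrow> nat" where
  "row_fun \<mu> i = (if i < length \<mu> then \<mu> ! i else 0)"

lemma cells_row_fun: "cells (row_fun \<mu>) = boxes \<mu>"
  by (auto simp: cells_def row_fun_def boxes_def split: if_splits)

lemma card_boxes: "finite (boxes \<mu>)" "card (boxes \<mu>) = sum_list \<mu>"
proof -
  have "boxes \<mu> = (SIGMA i:{..<length \<mu>}. {..<\<mu> ! i})" by (auto simp: boxes_def)
  then show "finite (boxes \<mu>)" "card (boxes \<mu>) = sum_list \<mu>"
    by (auto simp: sum_list_sum_nth atLeast0LessThan)
qed

lemma antimono_row_fun: "young_diagram \<mu> \<Longrightarrow> antimono (row_fun \<mu>)"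
  by (auto simp: antimono_iff_le_Suc row_fun_def young_diagram_def sorted_wrt_iff_nth_less)

lemma signature_of_nonneg_GT:
  assumes "young_diagram \<mu>" "length \<mu> \<le> N"
  shows "signature_of \<mu> N \<in> nonneg_GT N"
proof -
  have "sorted_wrt (\<ge>) (replicate k (0::int))" for k by (induction k) auto
  then show ?thesis
    using assms by (auto simp: nonneg_GT_def GT_def signature_of_def young_diagram_def
        sorted_wrt_append sorted_wrt_map)
qed

lemma rows_signature_of: "rows (signature_of \<mu> N) = row_fun \<mu>"
  by (auto simp: rows_def row_fun_def signature_of_def nth_append fun_eq_iff)

theorem theorem4p4p1:
  fixes r r' :: real
    and \<mu> \<nu> :: "nat list"
    and N N' :: "nat \<Rightarrow> nat"
  assumes "0 < r" and "r < r'"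
    and "young_diagram \<mu>" and "young_diagram \<nu>"
    and "boxes \<mu> \<subseteq> boxes \<nu>"
    and "\<And>k. 0 < N k" and "\<And>k. N k < N' k"
    and "filterlim N at_top sequentially"
    and "filterlim N' at_top sequentially"
    and "(\<lambda>k. real (N' k) / real (N k)) \<longlonglongrightarrow> r' / r"
  shows "(\<lambda>k. GT_link (N' k) (N k) (signature_of \<nu> (N' k)) (signature_of \<mu> (N k)))
           \<longlonglongrightarrow> YB_link r' r \<nu> \<mu>"
proof -
  note pos = assms(6) and less = assms(7) and limN = assms(8) and limN' = assms(9)
    and ratio = assms(10)
  let ?p = "row_fun \<mu>" and ?q = "row_fun \<nu>" and ?o = "\<lambda>_. 0 :: nat"
  define m n where "m = sum_list \<mu>" and "n = sum_list \<nu>"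
  define f g h where "f = real (YB_dim \<mu>)" and "g = real (YB_dim_between \<mu> \<nu>)"
    and "h = real (YB_dim \<nu>)"
  define d where "d = n - m"
  have "m \<le> n"
    unfolding m_def n_def using card_mono[OF card_boxes(1) assms(5)] by (simp add: card_boxes)
  then have n: "n = m + d" by (simp add: d_def)
  have o: "antimono ?o" "cells ?o = {}" by (auto simp: antimono_def cells_def)
  have le: "?o \<le> ?p" "?o \<le> ?q" "?p \<le> ?q"
    using assms(5) by (auto simp: le_fun_def cells_row_fun[symmetric] cells_subset_iff)
  note shapes = antimono_row_fun[OF assms(3)] antimono_row_fun[OF assms(4)]
    cells_row_fun card_boxes
  have A: "(\<lambda>k. real (strip_chains k ?o ?p) / real k ^ m) \<longlonglongrightarrow> f / fact m"
    using strip_chains_asymptotics[of ?o ?p m] o le by (simp add: shapes f_def YB_dim_def m_def)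
  have B: "(\<lambda>k. real (strip_chains k ?p ?q) / real k ^ d) \<longlonglongrightarrow> g / fact d"
    using strip_chains_asymptotics[of ?p ?q d] le n
    by (simp add: shapes g_def YB_dim_between_def m_def n_def)
  have C: "(\<lambda>k. real (strip_chains k ?o ?q) / real k ^ n) \<longlonglongrightarrow> h / fact n"
    using strip_chains_asymptotics[of ?o ?q n] o le by (simp add: shapes h_def YB_dim_def n_def)
  have h: "h \<noteq> 0"
    using standard_tableaux_exist[OF card_boxes(1), of \<nu>] by (simp add: h_def YB_dim_def)
  have limD: "filterlim (\<lambda>k. N' k - N k) at_top sequentially"
  proof -
    have "filterlim (\<lambda>k. (real (N' k) / real (N k) - 1) * real (N k)) at_top sequentially"
    proof (rule filterlim_tendsto_pos_mult_at_top)
      show "(\<lambda>k. real (N' k) / real (N k) - 1) \<longlonglongrightarrow> r' / r - 1"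
        by (intro tendsto_intros ratio)
      show "0 < r' / r - 1" using assms(1,2) by simp
      show "filterlim (\<lambda>k. real (N k)) at_top sequentially"
        by (rule filterlim_compose[OF filterlim_real_sequentially limN])
    qed
    also have "(\<lambda>k. (real (N' k) / real (N k) - 1) * real (N k)) = (\<lambda>k. real (N' k - N k))"
      using pos less by (auto simp: fun_eq_iff field_simps of_nat_diff less_imp_le)
    finally show ?thesis by (simp add: filterlim_sequentially_iff_filterlim_real)
  qed
  have ratio': "(\<lambda>k. real (N k) / real (N' k)) \<longlonglongrightarrow> r / r'"
    using tendsto_inverse[OF ratio] assms(1,2) by simp
  have "(\<lambda>k. (real (strip_chains (N k) ?o ?p) / real (N k) ^ m)
        * (real (strip_chains (N' k - N k) ?p ?q) / real (N' k - N k) ^ d)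
        / (real (strip_chains (N' k) ?o ?q) / real (N' k) ^ n)
        * ((1 - real (N k) / real (N' k)) ^ d * (real (N k) / real (N' k)) ^ m))
      \<longlonglongrightarrow> (f / fact m) * (g / fact d) / (h / fact n) * ((1 - r / r') ^ d * (r / r') ^ m)"
    by (intro tendsto_intros ratio' filterlim_compose[OF A limN] filterlim_compose[OF B limD]
        filterlim_compose[OF C limN']) (use h in simp)
  also have "(f / fact m) * (g / fact d) / (h / fact n) * ((1 - r / r') ^ d * (r / r') ^ m)
      = YB_link r' r \<nu> \<mu>"
    using assms(5) by (simp add: YB_link_def Let_def f_def g_def h_def m_def n_def d_def mult_ac)
  finally show ?thesis
  proof (rule Lim_transform_eventually)
    \<comment> \<open>For such \<open>k\<close> both diagrams have few enough rows for \<open>[\<mu>, N]\<close> and \<open>[\<nu>, N']\<close> to make sense.\<close>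
    have "\<forall>\<^sub>F k in sequentially. length \<mu> + length \<nu> \<le> N k"
      using limN by (simp add: filterlim_at_top)
    then show "\<forall>\<^sub>F k in sequentially. (real (strip_chains (N k) ?o ?p) / real (N k) ^ m)
        * (real (strip_chains (N' k - N k) ?p ?q) / real (N' k - N k) ^ d)
        / (real (strip_chains (N' k) ?o ?q) / real (N' k) ^ n)
        * ((1 - real (N k) / real (N' k)) ^ d * (real (N k) / real (N' k)) ^ m)
        = GT_link (N' k) (N k) (signature_of \<nu> (N' k)) (signature_of \<mu> (N k))"
    proof (rule eventually_mono)
      fix k assume k: "length \<mu> + length \<nu> \<le> N k"
      have sig: "signature_of \<mu> (N k) \<in> nonneg_GT (N k)" "signature_of \<nu> (N' k) \<in> nonneg_GT (N' k)"
        using k less[of k] by (auto intro!: signature_of_nonneg_GT assms(3,4))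
      have link: "GT_link (N' k) (N k) (signature_of \<nu> (N' k)) (signature_of \<mu> (N k))
          = real (strip_chains (N k) ?o ?p) * real (strip_chains (N' k - N k) ?p ?q)
            / real (strip_chains (N' k) ?o ?q)"
        unfolding GT_link_def
        using GT_Dim_eq_strip_chains[OF pos sig(1)] GT_Dim_eq_strip_chains[OF _ sig(2)]
          GT_Dim_between_eq_strip_chains[OF _ sig] less[of k] pos[of k]
        by (simp add: rows_signature_of)
      have "1 - real (N k) / real (N' k) = real (N' k - N k) / real (N' k)"
        using less[of k] by (simp add: field_simps of_nat_diff)
      note one_minus = this
      have cancel: "x / a * (y / b) / (z / (u * v)) * (b / v * (a / u)) = x * y / z"
        if "a \<noteq> 0" "b \<noteq> 0" "u \<noteq> 0" "v \<noteq> 0" for a b u v x y z :: real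
        using that by (cases "z = 0") (simp_all add: field_simps)
      show "(real (strip_chains (N k) ?o ?p) / real (N k) ^ m)
        * (real (strip_chains (N' k - N k) ?p ?q) / real (N' k - N k) ^ d)
        / (real (strip_chains (N' k) ?o ?q) / real (N' k) ^ n)
        * ((1 - real (N k) / real (N' k)) ^ d * (real (N k) / real (N' k)) ^ m)
        = GT_link (N' k) (N k) (signature_of \<nu> (N' k)) (signature_of \<mu> (N k))"
        unfolding link one_minus power_divide n power_add
        by (rule cancel) (use less[of k] pos[of k] in auto)
    qed
  qed
qed

end
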